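(* Let $c=pqrs$ be a conductor of cyclic cubic fields with four prime-power divisors $p,q,r,s$ (distinct primes $\equiv1\pmod 3$, or the prime power $9$). Let $\mathcal{G}$ be the directed graph on the vertex set $\{p,q,r,s\}$ with an arrow $x\to y$ ($x\ne y$) iff $\left(\frac{x}{y}\right)_3=1$. Suppose $\mathcal{G}$ satisfies: (1) there is no pair $x,y$ with both $x\to y$ and $y\to x$; (2) there is no attractive vertex; (3) there is no repulsive vertex; (4) for every $3$-element subset $\{x,y,z\}$ of vertices spanning no arrows, the invariant $\delta=a_{xy}a_{yz}a_{zx}-a_{xz}a_{zy}a_{yx}$ satisfies $\delta\not\equiv0\pmod 3$. Then for each of the four $3$-element subsets $\{p,q,r\},\{p,q,s\},\{p,r,s\},\{q,r,s\}$ the induced subgraph is of one of the types III.1, III.2, III.3, III.4; and $\mathcal{G}$ is isomorphic (as a directed graph) to one of the following seven graphs: (i) no arrows; (ii) $p\to q$ only; (iii) $p\to q$, $r\to s$ only; (iv) $p\to q\to r$ only; (v) $p\to q\to r\to p$ only; (vi) $p\to q\to r\to s$ only; (vii) $p\to q\to r\to s\to p$ only.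
   Context: Cubic residue symbols: $\left(\frac{x}{y}\right)_3=\zeta_3^{a_{xy}}$ with $a_{xy}\in\{-1,0,1\}$ (values in the cube roots of unity, with respect to fixed choices of primes of $\mathbb{Z}[\zeta_3]$ above the divisors; for the divisor $9$ the usual conventions apply), so $x\to y$ iff $a_{xy}=0$. A vertex $v$ is attractive if there are two distinct other vertices $u,w$ with $u\to v$ and $w\to v$; it is repulsive if there are two distinct other vertices $u,w$ with $v\to u$ and $v\to w$. Types of a directed graph on three vertices $\{x,y,z\}$: III.1 = no arrows and $\delta\not\equiv 0\pmod 3$ (with $\delta$ as in the claim); III.2 = exactly one arrow; III.3 = exactly two arrows, forming a directed path $x\to y\to z$ (for some ordering); III.4 = exactly three arrows, forming a directed $3$-cycle $x\to y\to z\to x$. A graph satisfying (1)–(4) is called the graph of a tame octet. *)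

theory Defs
  imports
    Complex_Main
    "HOL-Number_Theory.Cong"
    "HOL-Algebra.QuotRing"
    "Graph_Theory.Graph_Theory"
begin

definition zeta3 :: complex where
  "zeta3 = cis (2 * pi / 3)"

definition eisenstein_ring :: "complex ring" where
  "eisenstein_ring =
     \<lparr>carrier = {of_int a + of_int b * zeta3 | a b. True},
      monoid.mult = (*), one = 1, zero = 0, add = (+)\<rparr>"

definition prime_above :: "complex set \<Rightarrow> nat \<Rightarrow> bool" where
  "prime_above \<pp> y \<longleftrightarrow> primeideal \<pp> eisenstein_ring \<and> of_nat y \<in> \<pp>"

definition ideal_norm :: "complex set \<Rightarrow> nat" where
  "ideal_norm \<pp> = card (carrier (eisenstein_ring Quot \<pp>))"

text \<open>Euler's criterion; the value is unique when the norm is congruent to 1 modulo 3 and \<open>x \<notin> \<pp>\<close>.\<close>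

definition cubic_residue_symbol_prime :: "nat \<Rightarrow> complex set \<Rightarrow> complex" where
  "cubic_residue_symbol_prime x \<pp> =
     (THE z. z \<in> {1, zeta3, zeta3\<^sup>2} \<and>
             of_nat x ^ ((ideal_norm \<pp> - 1) div 3) - z \<in> \<pp>)"

text \<open>
  \<open>\<pp>\<close> selects the prime of \<open>\<int>[\<zeta>\<^sub>3]\<close> above each divisor.  The prime above 3 is ramified of norm 3
  and carries no cubic residue symbol; for the divisor 9 the symbol is a cubic character modulo 9,
  trivial exactly on the classes of \<open>1\<close> and \<open>-1\<close>, here \<open>x \<mapsto> \<zeta>\<^sub>3\<^bsup>(x\<^sup>2 - 1)/3\<^esup>\<close>.
  The only other nontrivial cubic character modulo 9 is its complex conjugate.  Like passing to
  the conjugate prime for another divisor, replacing one by the other leaves the arrows of the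
  residue graph unchanged and at most changes the sign of the invariant \<open>\<delta>\<close>.
\<close>

definition cubic_residue_symbol :: "(nat \<Rightarrow> complex set) \<Rightarrow> nat \<Rightarrow> nat \<Rightarrow> complex" where
  "cubic_residue_symbol \<pp> x y =
     (if y = 9 then zeta3 ^ ((x\<^sup>2 - 1) div 3) else cubic_residue_symbol_prime x (\<pp> y))"

definition cubic_residue_exponent :: "(nat \<Rightarrow> complex set) \<Rightarrow> nat \<Rightarrow> nat \<Rightarrow> int" where
  "cubic_residue_exponent \<pp> x y =
     (THE a. a \<in> {-1, 0, 1} \<and> cubic_residue_symbol \<pp> x y = zeta3 powi a)"

definition cubic_conductor_divisor :: "nat \<Rightarrow> bool" where
  "cubic_conductor_divisor y \<longleftrightarrow> (prime y \<and> [y = 1] (mod 3)) \<or> y = 9"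

definition residue_graph :: "(nat \<Rightarrow> complex set) \<Rightarrow> nat set \<Rightarrow> nat pair_pre_digraph" where
  "residue_graph \<pp> V =
     \<lparr>pverts = V,
      parcs = {(x, y). x \<in> V \<and> y \<in> V \<and> x \<noteq> y \<and> cubic_residue_symbol \<pp> x y = 1}\<rparr>"

definition attractive :: "('a, 'b) pre_digraph \<Rightarrow> 'a \<Rightarrow> bool" where
  "attractive G v \<longleftrightarrow>
     (\<exists>u\<in>verts G. \<exists>w\<in>verts G. distinct [u, v, w] \<and> u \<rightarrow>\<^bsub>G\<^esub> v \<and> w \<rightarrow>\<^bsub>G\<^esub> v)"

definition repulsive :: "('a, 'b) pre_digraph \<Rightarrow> 'a \<Rightarrow> bool" where
  "repulsive G v \<longleftrightarrow>
     (\<exists>u\<in>verts G. \<exists>w\<in>verts G. distinct [u, v, w] \<and> v \<rightarrow>\<^bsub>G\<^esub> u \<and> v \<rightarrow>\<^bsub>G\<^esub> w)"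

definition delta_invariant :: "('a \<Rightarrow> 'a \<Rightarrow> int) \<Rightarrow> 'a \<Rightarrow> 'a \<Rightarrow> 'a \<Rightarrow> int" where
  "delta_invariant a x y z = a x y * a y z * a z x - a x z * a z y * a y x"

text \<open>
  Permuting \<open>x\<close>, \<open>y\<close>, \<open>z\<close> changes \<open>\<delta>\<close> at most by its sign, so its vanishing modulo 3
  depends only on the set \<open>{x, y, z}\<close>.
\<close>

lemma delta_invariant_rotate: "delta_invariant a y z x = delta_invariant a x y z"
  by (simp add: delta_invariant_def mult.commute mult.left_commute)

lemma delta_invariant_swap: "delta_invariant a x z y = - delta_invariant a x y z"
  by (simp add: delta_invariant_def)

definition type_III_1 :: "('a \<Rightarrow> 'a \<Rightarrow> int) \<Rightarrow> ('a, 'b) pre_digraph \<Rightarrow> bool" where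
  "type_III_1 a H \<longleftrightarrow>
     arcs_ends H = {} \<and>
     (\<forall>x y z. verts H = {x, y, z} \<and> distinct [x, y, z] \<longrightarrow>
        \<not> [delta_invariant a x y z = 0] (mod 3))"

definition type_III_2 :: "('a, 'b) pre_digraph \<Rightarrow> bool" where
  "type_III_2 H \<longleftrightarrow> card (arcs_ends H) = 1"

definition type_III_3 :: "('a, 'b) pre_digraph \<Rightarrow> bool" where
  "type_III_3 H \<longleftrightarrow>
     (\<exists>x y z. verts H = {x, y, z} \<and> distinct [x, y, z] \<and> arcs_ends H = {(x, y), (y, z)})"

definition type_III_4 :: "('a, 'b) pre_digraph \<Rightarrow> bool" where
  "type_III_4 H \<longleftrightarrow>
     (\<exists>x y z. verts H = {x, y, z} \<and> distinct [x, y, z] \<and>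
        arcs_ends H = {(x, y), (y, z), (z, x)})"

end

theory Submission
  imports Defs
begin

text \<open>
  The hypotheses on \<open>G\<close> say that the arrow relation \<open>E\<close> is asymmetric and a partial injection of the
  vertex set into itself, so its components are directed paths and directed cycles of length at
  least 3.  On three or four vertices such a relation is determined by the lengths of its
  components: either no two arrows are composable, and then the arrows are pairwise disjoint, or
  there is a path \<open>w \<rightarrow> x \<rightarrow> y\<close>, and then the only further arrows possible are \<open>y \<rightarrow> w\<close>, \<open>y \<rightarrow> z\<close> and
  \<open>z \<rightarrow> w\<close> with \<open>z\<close> the fourth vertex.
\<close>

text \<open>Since \<open>w\<close> and \<open>x\<close> have used their only outgoing arrow and
  \<open>x\<close> and \<open>y\<close> their only incoming one, any further arrow starts outside
  \<open>{w, x}\<close> and ends outside \<open>{x, y}\<close>. This cuts the candidates down to a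
  short list in both classifications below.\<close>

lemma asym_partial_inj_path_extension:
  assumes "asym E" "single_valued E" "single_valued (E\<inverse>)"
    and "(w, x) \<in> E" "(x, y) \<in> E"
    and "(u, v) \<in> E"
  shows "(u, v) = (w, x) \<or> (u, v) = (x, y) \<or> (u \<noteq> w \<and> u \<noteq> x \<and> v \<noteq> x \<and> v \<noteq> y)"
  using assms by (auto dest: single_valuedD)

lemma asym_partial_inj_three:
  assumes E: "E \<subseteq> V \<times> V" "asym E" "single_valued E" "single_valued (E\<inverse>)"
    and V: "card V = 3"
  obtains "E = {}"
  | x y where "E = {(x, y)}"
  | x y z where "V = {x, y, z}" "distinct [x, y, z]" "E = {(x, y), (y, z)}"
  | x y z where "V = {x, y, z}" "distinct [x, y, z]" "E = {(x, y), (y, z), (z, x)}"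
proof (cases "\<exists>x y z. (x, y) \<in> E \<and> (y, z) \<in> E")
  case True
  then obtain x y z where arcs: "(x, y) \<in> E" "(y, z) \<in> E" by blast
  then have dist: "distinct [x, y, z]" using E(2) by (auto dest: asymD)
  have "{x, y, z} \<subseteq> V" "finite V" using arcs E(1) V card.infinite by (auto, fastforce)
  then have Veq: "V = {x, y, z}"
    using dist V by (intro card_subset_eq[symmetric]) auto
  \<comment> \<open>A further arrow has to start outside \<open>{x, y}\<close> and end outside
    \<open>{y, z}\<close>, so it can only close the cycle.\<close>
  have "E \<subseteq> {(x, y), (y, z), (z, x)}"
    using asym_partial_inj_path_extension[OF E(2-4) arcs] E(1) Veq by fast
  then have "E = {(x, y), (y, z)} \<or> E = {(x, y), (y, z), (z, x)}"
    using arcs by blast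
  then show thesis using that(3,4) Veq dist by blast
next
  case False
  show thesis
  proof (cases "E = {}")
    case nonempty: False
    then obtain x y where xy: "(x, y) \<in> E" by auto
    have "e = (x, y)" if "e \<in> E" for e
    proof (rule ccontr)
      assume ne: "e \<noteq> (x, y)"
      obtain u v where uv: "e = (u, v)" by force
      \<comment> \<open>A common source or a common target would contradict partial injectivity, and
        a target of one arrow equal to the source of the other would give a composable pair. So two
        arrows need four vertices.\<close>
      have "distinct [x, y, u, v]"
        using ne False xy that E(2-4) unfolding uv by (auto dest: asymD single_valuedD)
      then have "card {x, y, u, v} = 4" by simp
      moreover have "{x, y, u, v} \<subseteq> V" using xy that E(1) unfolding uv by auto
      moreover have "finite V" using V card.infinite by fastforce
      ultimately show False using V by (metis card_mono numeral_le_iff semiring_norm(69,72))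
    qed
    then show thesis using that(2) xy by blast
  qed (rule that(1))
qed

text \<open>The labelling of the vertices is part of what is obtained, so that \<open>E\<close>
  equals an entry of a fixed list and no isomorphism has to be mentioned yet.\<close>

lemma asym_partial_inj_four:
  assumes E: "E \<subseteq> V \<times> V" "asym E" "single_valued E" "single_valued (E\<inverse>)"
    and V: "card V = 4"
  obtains w x y z where "V = {w, x, y, z}" "distinct [w, x, y, z]"
    "E \<in> {{},
          {(w, x)},
          {(w, x), (y, z)},
          {(w, x), (x, y)},
          {(w, x), (x, y), (y, w)},
          {(w, x), (x, y), (y, z)},
          {(w, x), (x, y), (y, z), (z, w)}}"
proof (cases "\<exists>w x y. (w, x) \<in> E \<and> (x, y) \<in> E")
  case True
  then obtain w x y where arcs: "(w, x) \<in> E" "(x, y) \<in> E" by blast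
  then have dist3: "distinct [w, x, y]" using E(2) by (auto dest: asymD)
  have sub: "{w, x, y} \<subseteq> V" using arcs E(1) by auto
  have "card (V - {w, x, y}) = 1"
    using dist3 V sub by (simp add: card_Diff_subset)
  then obtain z where "V - {w, x, y} = {z}" by (auto simp: card_1_singleton_iff)
  then have Veq: "V = {w, x, y, z}" and dist: "distinct [w, x, y, z]"
    using sub dist3 by auto
  have "E \<subseteq> {(w, x), (x, y), (y, w), (y, z), (z, w)}"
  proof
    fix e assume e: "e \<in> E"
    obtain u v where uv: "e = (u, v)" by force
    have "u \<noteq> v" "u \<in> V" "v \<in> V" using e uv E(1,2) by (auto dest: asymD)
    then show "e \<in> {(w, x), (x, y), (y, w), (y, z), (z, w)}"
      using asym_partial_inj_path_extension[OF E(2-4) arcs, of u v] e unfolding uv Veq by blast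
  qed
  \<comment> \<open>The arrow from \<open>y\<close> to \<open>w\<close> closes a 3-cycle and
    excludes both arrows at \<open>z\<close>.\<close>
  moreover have "\<not> ((y, w) \<in> E \<and> (y, z) \<in> E)" "\<not> ((y, w) \<in> E \<and> (z, w) \<in> E)"
    using E(3,4) dist by (auto dest: single_valuedD)
  ultimately consider "E = {(w, x), (x, y)}" | "E = {(w, x), (x, y), (y, w)}"
    | "E = {(w, x), (x, y), (y, z)}" | "E = {(z, w), (w, x), (x, y)}"
    | "E = {(w, x), (x, y), (y, z), (z, w)}"
    using arcs by blast
  then show thesis
  proof cases
    case 4
    \<comment> \<open>The path now begins at \<open>z\<close>, so the labels are shifted to start
      there.\<close>
    then show thesis using dist by (intro that[of z w x y]) (auto simp: Veq)
  qed (rule that[OF Veq dist], simp)+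
next
  case no_path: False
  show thesis
  proof (cases "E = {}")
    case True
    have "finite V" using V card.infinite by fastforce
    then obtain vs where vs: "set vs = V" "distinct vs" using finite_distinct_list by blast
    then have "length vs = 4" using V distinct_card by fastforce
    then obtain w x y z where "vs = [w, x, y, z]"
      by (auto simp: numeral_eq_Suc length_Suc_conv)
    then have "V = {w, x, y, z}" "distinct [w, x, y, z]" using vs by auto
    then show thesis using True by (intro that) auto
  next
    case False
    then obtain w x where wx: "(w, x) \<in> E" by auto
    then have "w \<noteq> x" "{w, x} \<subseteq> V" using E(1,2) by (auto dest: asymD)
    then have "card (V - {w, x}) = 2" using V by (simp add: card_Diff_subset)
    then obtain y z where yz: "V - {w, x} = {y, z}" "y \<noteq> z" by (auto simp: card_2_iff)
    then have Veq: "V = {w, x, y, z}" and dist: "distinct [w, x, y, z]"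
      using \<open>{w, x} \<subseteq> V\<close> \<open>w \<noteq> x\<close> by auto
    have "E \<subseteq> {(w, x), (y, z), (z, y)}"
    proof
      fix e assume e: "e \<in> E"
      obtain u v where uv: "e = (u, v)" by force
      have "u \<noteq> v" "u \<in> V" "v \<in> V" using e uv E(1,2) by (auto dest: asymD)
      \<comment> \<open>The last two hold because otherwise the arrow could be composed with the one
        from \<open>w\<close> to \<open>x\<close>. Hence any other arrow runs between the two
        remaining vertices.\<close>
      moreover have "u = w \<Longrightarrow> v = x" "v = x \<Longrightarrow> u = w" "u \<noteq> x" "v \<noteq> w"
        using e wx no_path E(3,4) unfolding uv by (auto dest: single_valuedD)
      ultimately show "e \<in> {(w, x), (y, z), (z, y)}" unfolding uv Veq by blast
    qed
    moreover have "\<not> ((y, z) \<in> E \<and> (z, y) \<in> E)" using E(2) by (auto dest: asymD)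
    ultimately consider "E = {(w, x)}" | "E = {(w, x), (y, z)}" | "E = {(w, x), (z, y)}"
      using wx by blast
    then show thesis
    proof cases
      case 3
      then show thesis using dist by (intro that[of w x z y]) (auto simp: Veq)
    qed (rule that[OF Veq dist], simp)+
  qed
qed

lemma arcs_ends_with_proj_restrict:
  "arcs_ends (with_proj P \<restriction> T) = parcs P \<inter> T \<times> T"
  by (auto simp: arcs_ends_conv)

text \<open>A digraph isomorphism consists of separate maps for vertices, arcs, heads and tails.
  Here arcs are pairs of vertices, so a vertex bijection \<open>f\<close> determines all
  four.\<close>

lemma digraph_iso_with_proj:
  assumes "parcs P \<subseteq> pverts P \<times> pverts P" "inj_on f (pverts P)"
    and "pverts Q = f ` pverts P" "parcs Q = map_prod f f ` parcs P"
  shows "digraph_iso (with_proj P) (with_proj Q)"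
proof -
  define h where
    "h = \<lparr>iso_verts = f, iso_arcs = map_prod f f, iso_head = snd, iso_tail = fst\<rparr>"
  have "wf_digraph (with_proj P)"
    using assms(1) by unfold_locales auto
  moreover have "inj_on (map_prod f f) (parcs P)"
    using map_prod_inj_on[OF assms(2,2)] assms(1) by (rule inj_on_subset)
  ultimately have "pre_digraph.digraph_isomorphism (with_proj P) h"
    using assms(2) by (simp add: pre_digraph.digraph_isomorphism_def h_def)
  moreover have "with_proj Q = app_iso h (with_proj P)"
    using assms(3,4) by (simp add: app_iso_def h_def with_proj_def)
  ultimately show ?thesis unfolding digraph_iso_def by blast
qed

theorem theoremA:
  fixes c p q r s :: nat
    and \<pp> :: "nat \<Rightarrow> complex set"
    and a :: "nat \<Rightarrow> nat \<Rightarrow> int"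
    and G :: "(nat, nat \<times> nat) pre_digraph"
  assumes "c = p * q * r * s"
    and "distinct [p, q, r, s]"
    and "\<forall>y\<in>{p, q, r, s}. cubic_conductor_divisor y"
    and "\<forall>y\<in>{p, q, r, s}. prime_above (\<pp> y) y"
    and "a = cubic_residue_exponent \<pp>"
    and "G = with_proj (residue_graph \<pp> {p, q, r, s})"
    and "\<not> (\<exists>x\<in>verts G. \<exists>y\<in>verts G. x \<rightarrow>\<^bsub>G\<^esub> y \<and> y \<rightarrow>\<^bsub>G\<^esub> x)"
    and "\<not> (\<exists>v\<in>verts G. attractive G v)"
    and "\<not> (\<exists>v\<in>verts G. repulsive G v)"
    and "\<forall>x\<in>verts G. \<forall>y\<in>verts G. \<forall>z\<in>verts G.
           distinct [x, y, z] \<and> arcs (G \<restriction> {x, y, z}) = {} \<longrightarrow>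
           \<not> [delta_invariant a x y z = 0] (mod 3)"
  shows "(\<forall>T\<in>{{p, q, r}, {p, q, s}, {p, r, s}, {q, r, s}}.
            type_III_1 a (G \<restriction> T) \<or> type_III_2 (G \<restriction> T) \<or>
            type_III_3 (G \<restriction> T) \<or> type_III_4 (G \<restriction> T)) \<and>
         (\<exists>A\<in>{{},
               {(p, q)},
               {(p, q), (r, s)},
               {(p, q), (q, r)},
               {(p, q), (q, r), (r, p)},
               {(p, q), (q, r), (r, s)},
               {(p, q), (q, r), (r, s), (s, p)}}.
            digraph_iso G (with_proj \<lparr>pverts = {p, q, r, s}, parcs = A\<rparr>))"
proof -
  define V where "V = {p, q, r, s}"
  define E where "E = parcs (residue_graph \<pp> V)"
  have G: "G = with_proj (residue_graph \<pp> V)" using assms(6) by (simp add: V_def)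
  have verts_G: "verts G = V" by (simp add: G residue_graph_def)
  have dom_G: "u \<rightarrow>\<^bsub>G\<^esub> v \<longleftrightarrow> (u, v) \<in> E" for u v by (simp add: G E_def)
  have E_V: "E \<subseteq> V \<times> V" and irrefl: "(u, u) \<notin> E" for u
    by (auto simp: E_def residue_graph_def)
  have asym: "asym E"
    using assms(7) E_V unfolding verts_G dom_G by blast
  \<comment> \<open>Two different targets of \<open>v\<close> also differ from \<open>v\<close>, as
    \<open>E\<close> has no loops, and so make \<open>v\<close> repulsive. Attractive vertices give
    the converse relation in the same way.\<close>
  have sv: "single_valued E"
  proof (rule single_valuedI)
    fix v u w assume "(v, u) \<in> E" "(v, w) \<in> E"
    then show "u = w"
      using assms(9) E_V irrefl unfolding verts_G repulsive_def dom_G by fastforce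
  qed
  have sv_conv: "single_valued (E\<inverse>)"
  proof (rule single_valuedI)
    fix v u w assume "(v, u) \<in> E\<inverse>" "(v, w) \<in> E\<inverse>"
    then show "u = w"
      using assms(8) E_V irrefl unfolding verts_G attractive_def dom_G by fastforce
  qed

  have triple: "type_III_1 a (G \<restriction> T) \<or> type_III_2 (G \<restriction> T) \<or>
      type_III_3 (G \<restriction> T) \<or> type_III_4 (G \<restriction> T)"
    if T: "T \<subseteq> V" "card T = 3" for T
  proof -
    have ends: "arcs_ends (G \<restriction> T) = E \<inter> T \<times> T"
      by (simp only: G E_def arcs_ends_with_proj_restrict)
    have "asym (E \<inter> T \<times> T)" "single_valued (E \<inter> T \<times> T)" "single_valued ((E \<inter> T \<times> T)\<inverse>)"
      using asym sv sv_conv by (auto simp: single_valued_def dest: asymD)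
    then show ?thesis
    proof (rule asym_partial_inj_three[OF Int_lower2 _ _ _ T(2)])
      assume empty: "E \<inter> T \<times> T = {}"
      \<comment> \<open>Only a triple without arrows calls for hypothesis (4); the other shapes are
        types III.2 to III.4 as they stand.\<close>
      have "\<not> [delta_invariant a x y z = 0] (mod 3)"
        if "T = {x, y, z}" "distinct [x, y, z]" for x y z
      proof -
        have "arcs (G \<restriction> {x, y, z}) = {}"
          using empty ends that(1) by (simp add: arcs_ends_def)
        moreover have "x \<in> V" "y \<in> V" "z \<in> V" using T(1) that(1) by auto
        ultimately show ?thesis using assms(10) that(2) unfolding verts_G by blast
      qed
      then show ?thesis by (auto simp: type_III_1_def ends empty)
    next
      fix x y assume "E \<inter> T \<times> T = {(x, y)}"
      then show ?thesis by (simp add: type_III_2_def ends)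
    next
      fix x y z assume "T = {x, y, z}" "distinct [x, y, z]" "E \<inter> T \<times> T = {(x, y), (y, z)}"
      then have "type_III_3 (G \<restriction> T)"
        unfolding type_III_3_def ends induce_subgraph_verts by blast
      then show ?thesis by blast
    next
      fix x y z
      assume "T = {x, y, z}" "distinct [x, y, z]" "E \<inter> T \<times> T = {(x, y), (y, z), (z, x)}"
      then have "type_III_4 (G \<restriction> T)"
        unfolding type_III_4_def ends induce_subgraph_verts by blast
      then show ?thesis by blast
    qed
  qed

  have "card V = 4" using assms(2) by (simp add: V_def)
  then obtain w x y z where V: "V = {w, x, y, z}" and dist: "distinct [w, x, y, z]"
    and shape: "E \<in> {{}, {(w, x)}, {(w, x), (y, z)}, {(w, x), (x, y)},
      {(w, x), (x, y), (y, w)}, {(w, x), (x, y), (y, z)}, {(w, x), (x, y), (y, z), (z, w)}}"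
    by (rule asym_partial_inj_four[OF E_V asym sv sv_conv])
  \<comment> \<open>The labels \<open>w\<close>, \<open>x\<close>, \<open>y\<close>,
    \<open>z\<close> are again the vertices \<open>p\<close>, \<open>q\<close>, \<open>r\<close>,
    \<open>s\<close>, possibly in another order; \<open>f\<close> permutes them so that the shape of
    \<open>E\<close> becomes one of the seven listed graphs.\<close>
  define f where "f = id(w := p, x := q, y := r, z := s)"
  have f: "f w = p" "f x = q" "f y = r" "f z = s" using dist by (auto simp: f_def)
  have iso: "digraph_iso G (with_proj \<lparr>pverts = {p, q, r, s}, parcs = map_prod f f ` E\<rparr>)"
    unfolding G
  proof (rule digraph_iso_with_proj)
    show "parcs (residue_graph \<pp> V) \<subseteq> pverts (residue_graph \<pp> V) \<times> pverts (residue_graph \<pp> V)"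
      by (auto simp: residue_graph_def)
    have "card (f ` V) = card V"
      using assms(2) dist by (simp add: V f)
    moreover have "finite V" by (simp add: V)
    ultimately have "inj_on f V" by (intro eq_card_imp_inj_on)
    then show "inj_on f (pverts (residue_graph \<pp> V))" by (simp add: residue_graph_def)
    show "pverts \<lparr>pverts = {p, q, r, s}, parcs = map_prod f f ` E\<rparr> =
        f ` pverts (residue_graph \<pp> V)"
      by (simp add: residue_graph_def V f)
  qed (simp add: E_def)
  have edges: "map_prod f f ` E \<in> {{}, {(p, q)}, {(p, q), (r, s)}, {(p, q), (q, r)},
      {(p, q), (q, r), (r, p)}, {(p, q), (q, r), (r, s)}, {(p, q), (q, r), (r, s), (s, p)}}"
    \<comment> \<open>Taking images under \<open>map_prod f f\<close> turns the list of shapes,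
      entry by entry, into the list of the claim.\<close>
    using imageI[OF shape, of "(`) (map_prod f f)"]
    by (simp only: image_insert image_empty map_prod_simp f)
  show ?thesis
  proof (intro conjI ballI)
    fix T assume "T \<in> {{p, q, r}, {p, q, s}, {p, r, s}, {q, r, s}}"
    then have "T \<subseteq> V" "card T = 3" using assms(2) by (auto simp: V_def)
    then show "type_III_1 a (G \<restriction> T) \<or> type_III_2 (G \<restriction> T) \<or>
        type_III_3 (G \<restriction> T) \<or> type_III_4 (G \<restriction> T)"
      by (rule triple)
  qed (rule bexI[OF _ edges], rule iso)
qed

end
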